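(* Let $M\ge 2$ be an integer. If $4$ divides $M$, then an $M$-free $1$-partition of $n$ exists for all integers $n\ge 155$. If $6$ divides $M$, then an $M$-free $1$-partition of $n$ exists for all integers $n\ge 183$. If $9$ divides $M$, then an $M$-free $1$-partition of $n$ exists for all integers $n\ge 91$.
   Context: For a positive integer $n$, a $1$-partition of $n$ is a finite set $\{a_1,\ldots,a_r\}$ of distinct positive integers with $a_1+\cdots+a_r=n$ and $\frac1{a_1}+\cdots+\frac1{a_r}=1$. For an integer $M\ge 2$, it is $M$-free if none of the $a_i$ is divisible by $M$. *)

theory Defs
  imports Complex_Main
begin

definition one_partition :: "nat \<Rightarrow> nat set \<Rightarrow> bool" where
  "one_partition n A \<longleftrightarrow>
     finite A \<and> (\<forall>a\<in>A. 0 < a) \<and> \<Sum>A = n \<and> (\<Sum>a\<in>A. 1 / rat_of_nat a) = 1"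

definition is_free :: "nat \<Rightarrow> nat set \<Rightarrow> bool" where
  "is_free M A \<longleftrightarrow> (\<forall>a\<in>A. \<not> M dvd a)"

end

theory Submission
  imports Defs "HOL-Library.Code_Binary_Nat"
begin

text \<open>A set without multiples of 4 has no multiples of any \<open>M\<close> that 4 divides, and likewise for 6
  and 9, so only \<open>M = 4\<close>, \<open>M = 6\<close> and \<open>M = 9\<close> have to be treated.

  For each of them, large numbers are reached from smaller ones by a variant of Graham's doubling
  argument. Take an \<open>M\<close>-free partition \<open>A\<close> of \<open>m\<close>, a prime \<open>k\<close> that does not divide \<open>M\<close>, and an \<open>M\<close>-free
  set \<open>S\<close> with reciprocal sum \<open>1 - 1 / k\<close>. If \<open>k A\<close> and \<open>S\<close> are disjoint, then \<open>k A \<union> S\<close> is an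
  \<open>M\<close>-free partition of \<open>k m + \<Sum>S\<close>. Now \<open>k\<close> occurs in the denominator of \<open>1 - 1 / k\<close>, so \<open>S\<close> must
  contain some multiples \<open>k b\<close> of \<open>k\<close>, and disjointness means that none of these \<open>b\<close> lies in \<open>A\<close>.
  Hence one fixes a finite set \<open>B\<close> of numbers not divisible by \<open>k\<close> and works with partitions that avoid \<open>B\<close>:
  if \<open>S\<close> avoids \<open>B\<close> too and every multiple of \<open>k\<close> in \<open>S\<close> is \<open>k b\<close> with \<open>b \<in> B\<close>, then the new
  partition again avoids \<open>B\<close> (\<open>avoiding_partition_lift\<close>). The number 1 may always be put into \<open>B\<close>,
  because it occurs in no partition of a number above 1.

  Once the available \<open>S\<close> have sums in all residue classes modulo \<open>k\<close>, every large number is of the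
  form \<open>k m + \<Sum>S\<close> with \<open>m\<close> smaller but still large, and what remains is a finite set of
  explicit partitions (\<open>avoiding_partition_exists\<close>). The parameters are \<open>k = 3\<close> for \<open>M = 4\<close>, \<open>k = 5\<close>
  for \<open>M = 6\<close> and \<open>k = 2\<close> for \<open>M = 9\<close>, in each case the least prime that does not divide \<open>M\<close>; the
  sets \<open>B\<close>, the sets \<open>S\<close> and the explicit partitions were found by computer search and are checked
  here by symbolic evaluation.\<close>

section \<open>Multiplying a partition and adding a fixed set\<close>

definition avoiding_partition :: "nat \<Rightarrow> nat set \<Rightarrow> nat \<Rightarrow> nat set \<Rightarrow> bool" where
  "avoiding_partition M B n A \<longleftrightarrow> one_partition n A \<and> is_free M A \<and> A \<inter> B = {}"

text \<open>The sum of the reciprocals as a numerator and a denominator, never cancelled: in this form the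
  hundreds of sums needed below are evaluated with multiplications and additions of natural
  numbers only, without a gcd.\<close>
fun unreduced_sum :: "nat list \<Rightarrow> nat \<times> nat" where
  "unreduced_sum [] = (0, 1)"
| "unreduced_sum (x # xs) = (case unreduced_sum xs of (p, q) \<Rightarrow> (p * x + q, q * x))"

lemma unreduced_sum_correct:
  assumes "\<forall>x\<in>set xs. 0 < x" and "unreduced_sum xs = (p, q)"
  shows "0 < q \<and> (\<Sum>x\<leftarrow>xs. 1 / rat_of_nat x) = rat_of_nat p / rat_of_nat q"
  using assms
  by (induction xs arbitrary: p q) (auto simp: field_simps split: prod.splits)

text \<open>Strict increase is the cheapest test for distinctness: it compares neighbours only.\<close>
definition admissible :: "nat \<Rightarrow> nat set \<Rightarrow> nat list \<Rightarrow> bool" where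
  "admissible M B xs \<longleftrightarrow> successively (<) xs \<and> (\<forall>x\<in>set xs. 0 < x \<and> \<not> M dvd x \<and> x \<notin> B)"

definition seed :: "nat \<Rightarrow> nat set \<Rightarrow> nat list \<Rightarrow> bool" where
  "seed M B xs \<longleftrightarrow> admissible M B xs \<and> (case unreduced_sum xs of (p, q) \<Rightarrow> p = q)"

text \<open>The last condition says that the reciprocals add up to \<open>1 - 1 / k\<close>, see \<open>lifter_sum\<close>. The middle
  one makes the list disjoint from \<open>k\<close> times any set that avoids \<open>B\<close>.\<close>
definition lifter :: "nat \<Rightarrow> nat \<Rightarrow> nat set \<Rightarrow> nat list \<Rightarrow> bool" where
  "lifter M k B ys \<longleftrightarrow> admissible M B ys \<and> (\<forall>y\<in>set ys. k dvd y \<longrightarrow> y div k \<in> B) \<and>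
     (case unreduced_sum ys of (p, q) \<Rightarrow> k * p + q = k * q)"

lemma admissible_sums:
  assumes "admissible M B xs"
  shows "\<Sum>(set xs) = sum_list xs"
    and "(\<Sum>x\<in>set xs. 1 / rat_of_nat x) = (\<Sum>x\<leftarrow>xs. 1 / rat_of_nat x)"
proof -
  have "distinct xs"
    using assms by (simp add: admissible_def successively_conv_sorted_wrt strict_sorted_iff)
  then show "\<Sum>(set xs) = sum_list xs"
    and "(\<Sum>x\<in>set xs. 1 / rat_of_nat x) = (\<Sum>x\<leftarrow>xs. 1 / rat_of_nat x)"
    by (simp_all add: sum_list_distinct_conv_sum_set sum_list_distinct_conv_sum_set[where f = id, simplified])
qed

lemma seed_partition:
  assumes "seed M B xs"
  shows "avoiding_partition M B (sum_list xs) (set xs)"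
proof -
  obtain p where "unreduced_sum xs = (p, p)" and adm: "admissible M B xs"
    using assms by (auto simp: seed_def)
  then have "(\<Sum>x\<leftarrow>xs. 1 / rat_of_nat x) = 1"
    using unreduced_sum_correct[of xs p p] by (auto simp: admissible_def)
  then show ?thesis
    using adm admissible_sums[OF adm]
    by (auto simp: avoiding_partition_def one_partition_def is_free_def admissible_def)
qed

lemma lifter_sum:
  assumes "lifter M k B ys" and "0 < k"
  shows "(\<Sum>y\<in>set ys. 1 / rat_of_nat y) = 1 - 1 / rat_of_nat k"
proof -
  obtain p q where pq: "unreduced_sum ys = (p, q)" "k * p + q = k * q" and adm: "admissible M B ys"
    using assms by (auto simp: lifter_def)
  have q: "0 < q" and sum: "(\<Sum>y\<leftarrow>ys. 1 / rat_of_nat y) = rat_of_nat p / rat_of_nat q"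
    using unreduced_sum_correct[OF _ pq(1)] adm by (auto simp: admissible_def)
  have "rat_of_nat k * rat_of_nat p + rat_of_nat q = rat_of_nat k * rat_of_nat q"
    using pq(2) by (metis of_nat_add of_nat_mult)
  then have "rat_of_nat p / rat_of_nat q = 1 - 1 / rat_of_nat k"
    using q assms(2) by (simp add: field_simps)
  then show ?thesis
    using admissible_sums(2)[OF adm] sum by simp
qed

text \<open>Multiplying by \<open>k\<close> brings the reciprocal sum down to \<open>1 / k\<close>, and the lifter restores \<open>1\<close>. The
  result avoids \<open>B\<close> again because \<open>B\<close> has no multiple of \<open>k\<close>, so the step can be iterated.\<close>
lemma avoiding_partition_lift:
  assumes A: "avoiding_partition M B m A"
    and k: "0 < k" "coprime M k" "\<forall>b\<in>B. \<not> k dvd b"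
    and ys: "lifter M k B ys"
  shows "avoiding_partition M B (k * m + sum_list ys) ((*) k ` A \<union> set ys)"
proof -
  have adm: "admissible M B ys"
    using ys by (simp add: lifter_def)
  have fin: "finite A" and elems: "\<forall>a\<in>A. 0 < a \<and> \<not> M dvd a \<and> a \<notin> B"
    using A by (auto simp: avoiding_partition_def one_partition_def is_free_def)
  have inj: "inj_on ((*) k) A"
    using k(1) by (simp add: inj_on_def)
  have disj: "(*) k ` A \<inter> set ys = {}"
    using elems ys k(1) by (auto simp: lifter_def)
  have "\<Sum>((*) k ` A) = k * m"
    using A by (simp add: sum.reindex[OF inj] avoiding_partition_def one_partition_def
        flip: sum_distrib_left)
  then have total: "\<Sum>((*) k ` A \<union> set ys) = k * m + sum_list ys"
    using fin disj admissible_sums(1)[OF adm] by (simp add: sum.union_disjoint)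
  have "(\<Sum>a\<in>(*) k ` A. 1 / rat_of_nat a) = (\<Sum>a\<in>A. 1 / rat_of_nat k * (1 / rat_of_nat a))"
    by (simp add: sum.reindex[OF inj])
  also have "\<dots> = 1 / rat_of_nat k"
    unfolding sum_distrib_left [symmetric]
    using A by (simp add: avoiding_partition_def one_partition_def)
  finally have recip: "(\<Sum>a\<in>(*) k ` A \<union> set ys. 1 / rat_of_nat a) = 1"
    using fin disj lifter_sum[OF ys k(1)] by (simp add: sum.union_disjoint)
  have "\<forall>a\<in>(*) k ` A \<union> set ys. 0 < a \<and> \<not> M dvd a \<and> a \<notin> B"
    using elems k adm by (auto simp: admissible_def coprime_dvd_mult_right_iff)
  with total recip fin show ?thesis
    by (auto simp: avoiding_partition_def one_partition_def is_free_def)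
qed

section \<open>Induction from finitely many seeds\<close>

text \<open>The numbers that the induction is about. Below the threshold \<open>t\<close> gaps are left, the numbers in \<open>E\<close>.
  Starting at a small \<open>lo\<close> in spite of them pays, since each small partition that is
  available lifts to larger ones, and the numbers reached in this way need no seed.\<close>
definition claimed :: "nat \<Rightarrow> nat \<Rightarrow> nat list \<Rightarrow> nat \<Rightarrow> bool" where
  "claimed lo t E n \<longleftrightarrow> lo \<le> n \<and> (t \<le> n \<or> n \<notin> set E)"

definition liftable :: "nat \<Rightarrow> (nat \<Rightarrow> bool) \<Rightarrow> nat list \<Rightarrow> nat \<Rightarrow> bool" where
  "liftable k P ss n \<longleftrightarrow> (\<exists>s\<in>set ss. s \<le> n \<and> k dvd n - s \<and> P ((n - s) div k))"

text \<open>Symbolic evaluation rewrites both operands of a conjunction or disjunction, but only the needed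
  branch of a conditional; the following code equations therefore use conditionals, so that the
  search in \<open>E\<close> is entered only when its outcome matters.\<close>
lemma claimed_code [code]:
  "claimed lo t E n = (if t \<le> n then lo \<le> n else if lo \<le> n then n \<notin> set E else False)"
  by (auto simp: claimed_def)

lemma liftable_code [code]:
  "liftable k P [] n = False"
  "liftable k P (s # ss) n =
     (if s \<le> n then
        if (n - s) mod k = 0 then if P ((n - s) div k) then True else liftable k P ss n
        else liftable k P ss n
      else liftable k P ss n)"
  by (auto simp: liftable_def mod_eq_0_iff_dvd)

text \<open>Strong induction on \<open>n\<close>. The seeds are exactly the claimed numbers below \<open>hi\<close> that are not lifted
  from a claimed number. From \<open>hi\<close> on, the shift \<open>s\<close> with the same residue as \<open>n\<close> modulo \<open>k\<close> leads to
  \<open>(n - s) div k \<ge> t\<close>, where every number is claimed; so finitely many seeds suffice.\<close>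
lemma avoiding_partition_exists:
  assumes k: "2 \<le> k" "coprime M k" "\<forall>b\<in>B. \<not> k dvd b"
    and lifters: "\<forall>ys\<in>set lifters. lifter M k B ys" "map sum_list lifters = ss"
    and seeds: "\<forall>xs\<in>set seeds. seed M B xs"
      "map sum_list seeds =
         filter (\<lambda>n. if claimed lo t E n then \<not> liftable k (claimed lo t E) ss n else False) [lo..<hi]"
    and residues: "\<forall>j\<in>set [0..<k]. \<exists>s\<in>set ss. s mod k = j \<and> k * t + s \<le> hi"
    and "0 < lo" "lo \<le> t" "claimed lo t E n"
  shows "\<exists>A. avoiding_partition M B n A"
  using \<open>claimed lo t E n\<close>
proof (induction n rule: less_induct)
  case (less n)
  show ?case
  proof (cases "liftable k (claimed lo t E) ss n")
    case True
    then obtain ys where ys: "ys \<in> set lifters" "sum_list ys \<le> n" "k dvd n - sum_list ys"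
      "claimed lo t E ((n - sum_list ys) div k)"
      using lifters(2) by (auto simp: liftable_def)
    define m where "m = (n - sum_list ys) div k"
    have n: "n = k * m + sum_list ys"
      using ys(2,3) by (simp add: m_def)
    have "m < k * m"
      using ys(4) k(1) \<open>0 < lo\<close> by (simp add: m_def claimed_def)
    then have "m < n"
      unfolding n by linarith
    then obtain A where "avoiding_partition M B m A"
      using less.IH[of m] ys(4) by (auto simp: m_def)
    then have "avoiding_partition M B n ((*) k ` A \<union> set ys)"
      unfolding n using k lifters(1) ys(1) by (intro avoiding_partition_lift) auto
    then show ?thesis by blast
  next
    case False
    have "n < hi"
    proof (rule ccontr)
      assume "\<not> n < hi"
      have "n mod k \<in> set [0..<k]"
        using k(1) by simp
      with residues obtain s where s: "s \<in> set ss" "s mod k = n mod k" "k * t + s \<le> hi"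
        by blast
      have le: "k * t + s \<le> n"
        using s(3) \<open>\<not> n < hi\<close> by simp
      then have "t \<le> (n - s) div k"
        using k(1) by (simp add: less_eq_div_iff_mult_less_eq mult.commute)
      then have "claimed lo t E ((n - s) div k)"
        using \<open>lo \<le> t\<close> by (simp add: claimed_def)
      moreover have "s \<le> n" "k dvd n - s"
        using s(2) le by (simp, metis add_leD2 mod_eq_dvd_iff_nat)
      ultimately have "liftable k (claimed lo t E) ss n"
        using s(1) by (auto simp: liftable_def)
      with False show False ..
    qed
    with less.prems False have "n \<in> set (map sum_list seeds)"
      unfolding seeds(2) by (simp add: claimed_def)
    then obtain xs where "xs \<in> set seeds" "n = sum_list xs"
      by auto
    then show ?thesis
      using seeds(1) seed_partition by blast
  qed
qed

section \<open>Partitions without multiples of 4\<close>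

text \<open>Here \<open>k = 3\<close> and \<open>B = {1, 13, 22, 25}\<close>; the sums of the lifters are the shifts. All gaps lie below
  155, so \<open>t\<close> can be the bound itself. Among the least shifts in the residue classes modulo 3, the
  largest is 258, and \<open>hi = 3 * 155 + 258 = 723\<close>.\<close>

definition lifters4 :: "nat list list" where
  "lifters4 = [
     [3, 5, 10, 55, 66], [3, 5, 10, 50, 75], [3, 7, 11, 14, 66, 77], [3, 5, 14, 35, 50, 75],
     [3, 5, 11, 66, 70, 77], [3, 5, 11, 50, 75, 110], [2, 10, 50, 55, 66, 75],
     [3, 7, 14, 26, 35, 39, 65, 91], [2, 14, 35, 50, 55, 66, 75],
     [5, 7, 10, 11, 14, 50, 66, 75, 77], [2, 11, 50, 66, 70, 75, 77]]"

definition shifts4 :: "nat list" where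
  "shifts4 = [
     139, 143, 178, 182, 232, 254, 258, 280, 297, 315, 351]"

definition gaps4 :: "nat list" where
  "gaps4 = [
     31, 33, 34, 35, 36, 37, 38, 39, 40, 41, 42, 43, 44, 45, 46, 47, 48, 49, 50, 51, 52, 55, 56,
     57, 58, 59, 61, 62, 63, 64, 65, 66, 68, 70, 71, 72, 73, 75, 76, 77, 78, 79, 80, 83, 85, 87,
     88, 90, 91, 94, 97, 98, 100, 101, 102, 104, 105, 106, 107, 108, 109, 112, 114, 115, 116,
     119, 122, 126, 127, 128, 129, 130, 133, 134, 138, 143, 145, 152, 153, 154]"

definition seeds4 :: "nat list list" where
  "seeds4 = [
     [2, 3, 10, 15], [2, 3, 9, 18], [2, 5, 6, 10, 30], [2, 3, 7, 42], [2, 6, 9, 10, 15, 18],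
     [2, 5, 6, 9, 45], [2, 3, 14, 15, 35], [2, 5, 9, 10, 18, 30], [3, 5, 6, 9, 10, 18, 30],
     [2, 6, 7, 10, 15, 42], [2, 6, 7, 9, 18, 42], [2, 5, 9, 10, 15, 45], [2, 3, 9, 30, 45],
     [2, 5, 6, 14, 30, 35], [3, 5, 6, 9, 10, 15, 45], [2, 3, 9, 27, 54], [2, 5, 7, 10, 30, 42],
     [2, 6, 9, 14, 15, 18, 35], [3, 5, 6, 7, 10, 30, 42], [2, 5, 7, 9, 42, 45],
     [2, 5, 10, 14, 15, 30, 35], [2, 5, 9, 14, 18, 30, 35], [3, 5, 6, 7, 9, 42, 45],
     [2, 5, 6, 14, 21, 70], [3, 5, 6, 9, 14, 18, 30, 35], [2, 6, 7, 14, 15, 35, 42],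
     [2, 3, 10, 18, 90], [3, 5, 7, 9, 10, 18, 30, 42], [2, 5, 9, 14, 15, 35, 45],
     [2, 6, 7, 14, 18, 21, 63], [3, 5, 6, 9, 14, 15, 35, 45], [2, 5, 7, 14, 30, 35, 42],
     [2, 5, 6, 15, 18, 90], [2, 5, 9, 10, 27, 30, 54], [2, 5, 9, 14, 18, 21, 70],
     [2, 3, 14, 21, 30, 70], [2, 3, 11, 15, 110], [2, 3, 14, 18, 42, 63], [2, 5, 6, 10, 55, 66],
     [3, 5, 6, 9, 14, 18, 21, 70], [2, 6, 7, 9, 27, 42, 54], [2, 5, 6, 10, 50, 75],
     [3, 6, 7, 9, 14, 15, 18, 35, 42], [2, 5, 7, 10, 21, 105], [2, 6, 7, 10, 21, 35, 70],
     [2, 5, 7, 15, 21, 35, 70], [2, 3, 15, 17, 34, 85], [3, 5, 6, 7, 10, 21, 105],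
     [2, 5, 6, 10, 45, 90], [2, 5, 6, 18, 30, 35, 63], [2, 7, 9, 10, 15, 30, 42, 45],
     [2, 5, 7, 14, 21, 42, 70], [2, 3, 10, 35, 42, 70], [3, 5, 7, 9, 14, 18, 30, 35, 42],
     [2, 5, 6, 11, 30, 110], [2, 5, 9, 10, 18, 55, 66], [2, 3, 10, 30, 55, 66],
     [3, 6, 7, 9, 10, 15, 30, 42, 45], [3, 5, 6, 7, 14, 21, 42, 70], [2, 5, 9, 10, 18, 50, 75],
     [2, 5, 6, 10, 42, 105], [2, 5, 6, 15, 35, 45, 63], [3, 5, 6, 9, 10, 18, 55, 66],
     [3, 6, 7, 9, 10, 15, 27, 42, 54], [2, 5, 9, 15, 21, 35, 42, 45], [2, 5, 6, 15, 35, 42, 70],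
     [3, 5, 6, 9, 10, 18, 50, 75], [2, 5, 6, 14, 42, 45, 63], [3, 5, 7, 9, 10, 18, 21, 105],
     [2, 5, 9, 10, 18, 45, 90], [2, 3, 9, 45, 55, 66], [2, 3, 7, 78, 91],
     [2, 6, 9, 14, 15, 21, 45, 70], [2, 5, 6, 15, 30, 50, 75], [2, 3, 9, 45, 50, 75],
     [2, 5, 6, 18, 21, 63, 70], [2, 3, 10, 27, 54, 90], [2, 3, 7, 70, 105],
     [2, 6, 9, 10, 18, 35, 45, 63], [2, 5, 7, 14, 21, 35, 105], [3, 5, 6, 10, 11, 15, 30, 110],
     [2, 5, 7, 10, 42, 50, 75], [2, 3, 10, 30, 42, 105], [2, 5, 6, 15, 30, 45, 90],
     [3, 5, 6, 7, 10, 42, 55, 66], [2, 6, 7, 9, 21, 45, 105], [3, 5, 6, 7, 14, 21, 35, 105],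
     [2, 5, 6, 15, 26, 65, 78], [3, 5, 6, 7, 10, 42, 50, 75], [2, 5, 6, 15, 27, 54, 90],
     [2, 5, 7, 18, 27, 42, 45, 54], [2, 5, 7, 10, 42, 45, 90], [2, 3, 9, 35, 63, 90],
     [3, 5, 6, 9, 15, 18, 35, 42, 70], [3, 5, 6, 9, 11, 15, 45, 110], [2, 3, 14, 27, 42, 54, 63],
     [2, 3, 9, 42, 45, 105], [2, 3, 18, 21, 30, 63, 70], [3, 5, 6, 7, 10, 42, 45, 90],
     [2, 6, 7, 10, 15, 78, 91], [2, 6, 7, 10, 35, 42, 45, 63], [2, 6, 7, 9, 18, 78, 91],
     [2, 3, 9, 33, 66, 99], [2, 7, 9, 14, 18, 21, 30, 42, 70], [2, 5, 9, 15, 18, 30, 45, 90],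
     [2, 6, 7, 10, 15, 70, 105], [2, 6, 9, 10, 18, 27, 54, 90], [2, 6, 7, 9, 18, 70, 105],
     [2, 5, 9, 14, 18, 35, 45, 90], [2, 3, 15, 21, 45, 63, 70], [2, 5, 9, 15, 18, 27, 54, 90],
     [2, 3, 15, 27, 30, 54, 90], [2, 3, 10, 23, 69, 115], [2, 5, 7, 10, 30, 78, 91],
     [3, 5, 9, 10, 14, 15, 18, 42, 45, 63], [2, 3, 14, 27, 35, 54, 90],
     [2, 5, 9, 10, 30, 45, 50, 75], [3, 5, 7, 9, 14, 15, 21, 63, 90],
     [2, 5, 9, 10, 27, 54, 55, 66], [3, 5, 6, 7, 10, 30, 78, 91], [2, 3, 14, 21, 55, 66, 70],
     [2, 6, 7, 9, 42, 45, 55, 66], [2, 3, 11, 18, 90, 110], [2, 6, 7, 9, 42, 45, 50, 75],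
     [2, 5, 7, 9, 45, 78, 91], [2, 6, 7, 10, 27, 42, 54, 90], [2, 5, 9, 10, 26, 45, 65, 78],
     [3, 5, 7, 9, 10, 21, 27, 54, 105], [2, 5, 6, 21, 30, 45, 63, 70], [2, 5, 7, 9, 45, 70, 105],
     [3, 5, 6, 7, 9, 45, 78, 91], [2, 3, 14, 21, 45, 70, 90], [2, 6, 7, 10, 26, 39, 65, 91],
     [3, 5, 6, 9, 14, 15, 42, 63, 90], [2, 6, 7, 14, 15, 35, 78, 91], [2, 3, 15, 18, 55, 66, 90],
     [3, 5, 6, 7, 9, 45, 70, 105], [2, 3, 14, 21, 42, 78, 91], [2, 6, 9, 10, 18, 23, 69, 115],
     [2, 3, 15, 18, 50, 75, 90], [2, 6, 7, 9, 35, 42, 63, 90], [2, 5, 6, 11, 55, 66, 110],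
     [2, 5, 10, 11, 15, 66, 70, 77], [2, 3, 15, 23, 30, 69, 115], [2, 5, 9, 11, 18, 66, 70, 77],
     [2, 5, 6, 11, 50, 75, 110], [3, 5, 6, 9, 18, 21, 35, 42, 55, 66],
     [2, 3, 10, 50, 55, 66, 75], [2, 5, 7, 14, 30, 35, 78, 91], [3, 5, 7, 9, 10, 15, 45, 78, 91],
     [2, 6, 7, 9, 33, 42, 66, 99], [3, 5, 6, 9, 11, 18, 66, 70, 77],
     [3, 6, 7, 9, 10, 18, 27, 42, 54, 90], [2, 6, 9, 11, 21, 30, 45, 66, 77],
     [2, 5, 6, 11, 45, 90, 110], [2, 5, 6, 17, 34, 55, 66, 85], [2, 3, 10, 45, 55, 66, 90],
     [2, 3, 11, 35, 42, 70, 110], [2, 3, 10, 45, 50, 75, 90], [2, 5, 6, 18, 30, 50, 75, 90],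
     [2, 3, 11, 30, 55, 66, 110], [3, 5, 7, 9, 10, 14, 55, 77, 99],
     [2, 5, 7, 11, 42, 66, 70, 77], [2, 3, 11, 30, 50, 75, 110], [2, 3, 21, 26, 35, 39, 65, 91],
     [2, 3, 10, 42, 55, 66, 105], [2, 5, 6, 15, 45, 55, 66, 90],
     [3, 5, 6, 9, 10, 21, 55, 77, 99], [2, 3, 18, 30, 35, 45, 63, 90],
     [2, 3, 10, 42, 50, 75, 105], [2, 5, 6, 15, 45, 50, 75, 90], [2, 3, 10, 35, 70, 78, 91],
     [2, 5, 6, 18, 26, 65, 78, 90], [2, 3, 11, 30, 45, 90, 110], [2, 3, 18, 27, 35, 54, 63, 90],
     [2, 5, 7, 18, 35, 42, 55, 63, 66], [2, 3, 14, 42, 45, 50, 63, 75],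
     [2, 3, 11, 26, 65, 78, 110], [2, 5, 6, 15, 42, 55, 66, 105], [2, 5, 6, 10, 78, 91, 105],
     [2, 6, 7, 11, 33, 45, 55, 63, 77], [2, 3, 14, 35, 50, 55, 66, 75],
     [2, 3, 10, 33, 66, 90, 99], [2, 5, 6, 14, 45, 63, 78, 91], [2, 3, 15, 30, 45, 55, 66, 90],
     [2, 5, 7, 18, 35, 42, 45, 63, 90], [2, 5, 6, 14, 42, 70, 78, 91],
     [2, 6, 9, 10, 21, 30, 55, 77, 99], [2, 3, 14, 35, 45, 55, 66, 90],
     [2, 5, 7, 21, 27, 35, 54, 70, 90], [2, 3, 15, 27, 54, 55, 66, 90],
     [3, 5, 6, 7, 15, 18, 78, 90, 91], [2, 3, 14, 35, 45, 50, 75, 90], [2, 3, 9, 55, 70, 77, 99],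
     [2, 5, 6, 15, 33, 66, 90, 99], [2, 5, 9, 14, 21, 35, 55, 77, 99],
     [2, 5, 9, 10, 18, 78, 91, 105], [2, 3, 18, 21, 45, 55, 77, 99],
     [3, 5, 6, 7, 10, 55, 66, 78, 91], [2, 3, 15, 30, 35, 70, 78, 91],
     [2, 5, 9, 14, 18, 45, 63, 78, 91], [2, 3, 14, 30, 45, 63, 78, 91],
     [2, 5, 7, 18, 27, 45, 54, 78, 91], [2, 5, 6, 26, 35, 42, 65, 70, 78],
     [2, 3, 14, 30, 42, 70, 78, 91], [2, 5, 7, 14, 45, 50, 63, 70, 75],
     [2, 3, 14, 27, 54, 63, 78, 91], [2, 3, 9, 45, 78, 91, 105], [2, 5, 7, 11, 30, 78, 91, 110],
     [2, 5, 6, 27, 30, 54, 55, 66, 90], [2, 5, 6, 14, 35, 78, 91, 105],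
     [2, 3, 15, 30, 33, 66, 90, 99], [2, 5, 6, 27, 30, 50, 54, 75, 90],
     [2, 3, 14, 33, 35, 66, 90, 99], [2, 6, 9, 10, 15, 55, 70, 77, 99],
     [2, 5, 9, 10, 35, 45, 70, 78, 91], [3, 5, 6, 7, 10, 42, 78, 91, 105],
     [2, 6, 7, 10, 30, 55, 63, 77, 99], [2, 3, 26, 30, 35, 42, 65, 70, 78],
     [2, 3, 18, 21, 35, 65, 91, 117], [2, 5, 6, 21, 42, 45, 63, 78, 91],
     [2, 3, 21, 30, 45, 55, 63, 66, 70], [3, 5, 6, 9, 10, 33, 50, 66, 75, 99],
     [2, 5, 7, 14, 35, 55, 63, 77, 99], [2, 6, 7, 9, 45, 55, 66, 78, 91],
     [2, 5, 9, 18, 26, 35, 39, 65, 70, 91], [2, 6, 9, 10, 14, 63, 78, 90, 91],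
     [2, 3, 11, 45, 66, 70, 77, 90], [2, 6, 7, 15, 26, 42, 50, 65, 75, 78],
     [2, 5, 6, 18, 50, 55, 66, 75, 90], [2, 3, 17, 18, 51, 85, 90, 102],
     [2, 6, 9, 10, 14, 63, 70, 90, 105], [2, 5, 6, 23, 30, 55, 66, 69, 115],
     [2, 3, 11, 50, 55, 66, 75, 110], [2, 5, 6, 21, 35, 45, 78, 90, 91],
     [2, 3, 15, 23, 42, 69, 105, 115], [2, 5, 6, 18, 42, 63, 70, 78, 91],
     [2, 5, 6, 18, 45, 55, 70, 77, 99], [3, 5, 6, 7, 18, 23, 42, 69, 90, 115],
     [2, 7, 9, 11, 18, 21, 66, 77, 78, 91], [2, 3, 18, 35, 42, 55, 66, 70, 90],
     [2, 3, 14, 21, 70, 78, 91, 105], [2, 6, 7, 14, 30, 35, 55, 63, 77, 99],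
     [2, 6, 9, 10, 30, 33, 45, 66, 90, 99], [2, 5, 7, 27, 30, 35, 54, 63, 78, 91],
     [2, 6, 9, 10, 21, 50, 63, 70, 75, 90], [2, 3, 11, 42, 50, 75, 105, 110],
     [2, 3, 18, 30, 45, 55, 70, 77, 99], [2, 3, 15, 18, 78, 90, 91, 105],
     [2, 3, 18, 26, 55, 65, 66, 78, 90], [2, 3, 18, 26, 50, 65, 75, 78, 90],
     [2, 5, 6, 11, 78, 91, 105, 110], [2, 3, 15, 42, 45, 63, 70, 78, 91],
     [2, 3, 11, 33, 66, 90, 99, 110], [2, 3, 18, 27, 45, 54, 78, 91, 105],
     [2, 5, 7, 18, 35, 55, 63, 66, 70, 105], [2, 3, 15, 35, 45, 70, 78, 90, 91],
     [2, 6, 7, 15, 18, 55, 63, 77, 90, 99], [2, 3, 14, 42, 45, 70, 78, 90, 91],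
     [2, 3, 15, 35, 45, 63, 78, 91, 105], [2, 3, 14, 42, 45, 63, 78, 91, 105],
     [2, 6, 7, 10, 50, 55, 63, 75, 77, 99], [2, 3, 26, 39, 42, 45, 63, 65, 70, 91],
     [2, 3, 21, 45, 50, 55, 63, 66, 70, 75], [2, 3, 15, 33, 42, 77, 78, 91, 110],
     [2, 3, 14, 35, 55, 63, 77, 99, 105], [2, 3, 27, 30, 45, 54, 55, 70, 77, 99],
     [2, 3, 26, 30, 45, 50, 65, 75, 78, 90], [2, 5, 9, 11, 30, 55, 70, 77, 99, 110],
     [2, 6, 9, 10, 35, 45, 50, 70, 75, 78, 91], [2, 6, 7, 18, 30, 35, 42, 65, 70, 91, 117],
     [2, 3, 14, 34, 42, 78, 91, 102, 119], [2, 3, 21, 35, 45, 55, 66, 78, 90, 91],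
     [2, 3, 18, 42, 55, 63, 66, 70, 78, 91], [2, 6, 7, 14, 35, 45, 55, 66, 78, 90, 91],
     [2, 3, 21, 33, 45, 63, 66, 70, 90, 99], [2, 3, 26, 30, 39, 45, 65, 90, 91, 105],
     [2, 6, 7, 14, 30, 50, 55, 75, 77, 90, 99], [2, 6, 9, 10, 27, 50, 54, 75, 78, 91, 105],
     [2, 6, 7, 14, 33, 45, 50, 75, 77, 90, 110], [2, 3, 21, 30, 42, 55, 77, 90, 99, 105],
     [2, 5, 9, 14, 26, 63, 65, 70, 78, 90, 105], [2, 3, 18, 33, 50, 70, 75, 77, 90, 110],
     [2, 3, 14, 50, 63, 65, 75, 90, 91, 117], [2, 3, 18, 27, 54, 65, 90, 91, 105, 117],
     [2, 5, 6, 33, 42, 45, 77, 78, 90, 91, 110], [2, 3, 23, 42, 45, 55, 66, 69, 90, 105, 115],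
     [2, 6, 9, 10, 35, 42, 65, 70, 90, 91, 105, 117]]"

lemma four_free_partition:
  assumes "155 \<le> n"
  shows "\<exists>A. one_partition n A \<and> is_free 4 A"
proof (cases "claimed 30 155 gaps4 n")
  case True
  have "\<exists>A. avoiding_partition 4 {1, 13, 22, 25} n A"
  proof (rule avoiding_partition_exists[OF _ _ _ _ _ _ _ _ _ _ True])
    show "2 \<le> (3 :: nat)"
      by simp
    show "coprime 4 (3 :: nat)"
      by code_simp
    show "\<forall>b\<in>{1, 13, 22, 25}. \<not> 3 dvd (b :: nat)"
      by code_simp
    show "\<forall>ys\<in>set lifters4. lifter 4 3 {1, 13, 22, 25} ys"
      by code_simp
    show "map sum_list lifters4 = shifts4"
      by code_simp
    show "\<forall>xs\<in>set seeds4. seed 4 {1, 13, 22, 25} xs"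
      by code_simp
    show "map sum_list seeds4 =
      filter (\<lambda>n. if claimed 30 155 gaps4 n
                 then \<not> liftable 3 (claimed 30 155 gaps4) shifts4 n else False)
        [30..<723]"
      by code_simp
    show "\<forall>j\<in>set [0..<3]. \<exists>s\<in>set shifts4. s mod 3 = j \<and> 3 * 155 + s \<le> 723"
      by code_simp
  qed simp_all
  then show ?thesis
    by (auto simp: avoiding_partition_def)
next
  case False
  with assms show ?thesis
    by (simp add: claimed_def)
qed

section \<open>Partitions without multiples of 6\<close>

text \<open>Here \<open>k = 5\<close> and \<open>B = {1, 4, 13, 44}\<close>. The numbers 195, 198 and 203 are gaps above the bound 183,
  which puts \<open>t\<close> at 204; their partitions \<open>extra_seeds6\<close> contain elements of \<open>B\<close>. Among the least
  shifts in the residue classes modulo 5, the largest is 259, and \<open>hi = 5 * 204 + 259 = 1279\<close>.\<close>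

definition lifters6 :: "nat list list" where
  "lifters6 = [
     [2, 7, 14, 20, 28], [2, 8, 14, 20, 28, 56], [2, 11, 20, 21, 22, 28, 33],
     [3, 7, 11, 14, 20, 22, 28, 33], [2, 7, 16, 20, 28, 112], [3, 8, 11, 14, 20, 22, 28, 33, 56],
     [2, 9, 20, 21, 22, 28, 99], [3, 7, 9, 14, 20, 22, 28, 99], [2, 11, 20, 22, 26, 33, 39, 52],
     [3, 7, 8, 20, 21, 26, 39, 52, 56], [2, 11, 19, 20, 22, 33, 57, 76],
     [2, 7, 20, 22, 28, 63, 99], [2, 8, 16, 20, 28, 56, 112], [3, 8, 9, 14, 20, 22, 28, 56, 99],
     [2, 8, 20, 26, 33, 39, 52, 88], [2, 5, 20, 22, 220], [2, 9, 19, 20, 22, 57, 76, 99],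
     [3, 7, 9, 14, 20, 21, 52, 63, 117], [3, 8, 11, 16, 20, 22, 28, 33, 56, 112],
     [2, 19, 20, 21, 26, 28, 39, 52, 57, 76], [3, 7, 9, 20, 21, 22, 33, 56, 88, 99],
     [2, 11, 16, 20, 22, 56, 77, 88, 112]]"

definition shifts6 :: "nat list" where
  "shifts6 = [
     71, 128, 137, 138, 185, 195, 201, 202, 205, 232, 240, 241, 242, 259, 268, 269, 304, 306,
     309, 340, 358, 404]"

definition gaps6 :: "nat list" where
  "gaps6 = [
     60, 61, 62, 63, 64, 65, 66, 67, 68, 70, 72, 73, 74, 75, 77, 78, 79, 80, 81, 82, 83, 84, 87,
     88, 89, 90, 91, 92, 93, 94, 95, 96, 97, 98, 99, 100, 103, 104, 105, 106, 107, 108, 110, 111,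
     112, 113, 114, 115, 116, 117, 118, 122, 123, 126, 128, 129, 130, 131, 132, 136, 139, 144,
     145, 147, 151, 161, 162, 164, 167, 170, 179, 180, 182, 195, 198, 203]"

definition seeds6 :: "nat list list" where
  "seeds6 = [
     [2, 3, 14, 15, 35], [2, 3, 11, 22, 33], [2, 5, 7, 14, 20, 28], [2, 5, 8, 10, 20, 40],
     [2, 5, 9, 10, 15, 45], [2, 5, 10, 15, 20, 21, 28], [3, 5, 7, 10, 14, 15, 20, 28],
     [2, 7, 8, 10, 14, 28, 40], [2, 7, 8, 10, 15, 21, 56], [3, 5, 7, 8, 14, 15, 28, 40],
     [2, 5, 8, 10, 16, 80], [2, 5, 8, 14, 20, 35, 40], [2, 5, 9, 14, 15, 35, 45],
     [2, 5, 9, 11, 22, 33, 45], [2, 5, 8, 14, 20, 28, 56], [2, 3, 8, 33, 88], [2, 3, 9, 22, 99],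
     [2, 5, 10, 14, 15, 21, 70], [2, 3, 15, 20, 28, 70], [2, 7, 9, 14, 15, 20, 28, 45],
     [2, 3, 11, 15, 110], [2, 5, 11, 20, 21, 22, 28, 33], [3, 5, 7, 11, 14, 20, 22, 28, 33],
     [2, 5, 7, 15, 21, 40, 56], [2, 5, 7, 8, 56, 70], [2, 8, 9, 10, 15, 20, 40, 45],
     [2, 5, 7, 10, 21, 105], [3, 5, 8, 10, 11, 20, 22, 33, 40],
     [3, 5, 9, 10, 11, 15, 22, 33, 45], [3, 5, 7, 8, 9, 21, 45, 56], [2, 5, 7, 15, 21, 35, 70],
     [2, 3, 15, 17, 34, 85], [2, 5, 7, 14, 21, 45, 63], [2, 3, 10, 35, 45, 63],
     [3, 5, 8, 10, 14, 15, 20, 28, 56], [2, 5, 8, 14, 16, 35, 80], [2, 5, 8, 10, 28, 40, 70],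
     [2, 3, 15, 20, 25, 100], [2, 7, 8, 10, 20, 28, 35, 56],
     [3, 5, 10, 11, 15, 20, 21, 22, 28, 33], [2, 5, 10, 15, 20, 26, 39, 52],
     [2, 3, 21, 26, 28, 39, 52], [2, 3, 14, 20, 28, 105], [2, 8, 10, 14, 15, 21, 28, 35, 40],
     [3, 5, 7, 8, 10, 15, 56, 70], [2, 7, 8, 14, 16, 20, 28, 80], [2, 3, 10, 33, 40, 88],
     [3, 5, 7, 8, 15, 20, 28, 35, 56], [2, 5, 11, 14, 21, 22, 33, 70],
     [2, 5, 7, 14, 25, 28, 100], [2, 3, 15, 16, 35, 112], [2, 3, 9, 45, 50, 75],
     [2, 8, 9, 10, 15, 16, 45, 80], [3, 5, 8, 10, 14, 15, 16, 35, 80], [2, 3, 7, 70, 105],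
     [3, 5, 8, 10, 11, 16, 22, 33, 80], [2, 5, 7, 14, 21, 35, 105], [2, 5, 8, 9, 33, 45, 88],
     [3, 5, 8, 11, 14, 20, 22, 33, 35, 40], [3, 5, 9, 11, 14, 15, 22, 33, 35, 45],
     [2, 5, 7, 20, 28, 35, 40, 56], [2, 5, 9, 15, 20, 28, 45, 70], [2, 5, 8, 11, 20, 40, 110],
     [2, 5, 9, 11, 15, 45, 110], [2, 3, 20, 21, 28, 50, 75], [2, 7, 10, 14, 15, 21, 35, 40, 56],
     [3, 7, 8, 10, 14, 15, 16, 20, 28, 80], [2, 7, 8, 10, 14, 35, 56, 70],
     [2, 5, 10, 15, 19, 20, 57, 76], [2, 5, 8, 20, 21, 28, 33, 88], [2, 3, 19, 21, 28, 57, 76],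
     [2, 5, 8, 10, 21, 56, 105], [3, 5, 7, 8, 10, 14, 56, 105], [3, 5, 7, 8, 10, 28, 40, 45, 63],
     [2, 5, 11, 20, 22, 26, 33, 39, 52], [2, 5, 8, 17, 20, 34, 40, 85],
     [2, 7, 8, 9, 15, 45, 56, 70], [2, 7, 8, 10, 20, 21, 40, 105], [2, 5, 8, 10, 20, 65, 104],
     [2, 3, 14, 33, 35, 40, 88], [3, 5, 8, 9, 10, 20, 22, 40, 99],
     [3, 5, 7, 10, 11, 21, 22, 33, 105], [2, 7, 8, 15, 20, 21, 35, 40, 70],
     [2, 3, 15, 21, 45, 63, 70], [2, 7, 8, 11, 14, 28, 40, 110], [2, 5, 9, 15, 20, 25, 45, 100],
     [2, 3, 10, 23, 69, 115], [2, 7, 8, 10, 16, 28, 40, 112], [2, 3, 14, 28, 33, 56, 88],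
     [2, 3, 15, 22, 40, 55, 88], [2, 5, 7, 14, 16, 70, 112], [2, 8, 9, 10, 15, 28, 40, 45, 70],
     [2, 5, 9, 14, 20, 28, 45, 105], [2, 5, 7, 14, 35, 40, 56, 70],
     [2, 7, 8, 11, 15, 21, 56, 110], [2, 5, 11, 15, 22, 33, 35, 45, 63],
     [2, 5, 8, 11, 16, 80, 110], [3, 7, 8, 10, 11, 20, 22, 28, 33, 35, 56],
     [3, 5, 7, 8, 15, 16, 28, 40, 112], [2, 3, 14, 21, 50, 70, 75],
     [2, 8, 10, 14, 15, 16, 21, 70, 80], [3, 5, 7, 8, 20, 21, 26, 39, 52, 56],
     [2, 5, 8, 16, 20, 35, 40, 112], [2, 3, 15, 22, 35, 63, 99],
     [3, 7, 8, 9, 10, 14, 22, 28, 40, 99], [2, 5, 8, 14, 21, 33, 70, 88],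
     [2, 3, 16, 20, 33, 80, 88], [2, 5, 7, 9, 45, 70, 105], [2, 3, 8, 56, 70, 105],
     [2, 7, 8, 15, 17, 21, 34, 56, 85], [2, 5, 7, 20, 22, 28, 63, 99],
     [2, 5, 8, 16, 17, 34, 80, 85], [2, 5, 8, 15, 21, 28, 65, 104], [2, 3, 15, 20, 38, 76, 95],
     [2, 5, 7, 15, 26, 39, 65, 91], [2, 3, 11, 33, 55, 70, 77], [3, 5, 8, 9, 10, 16, 22, 80, 99],
     [2, 3, 14, 21, 45, 63, 105], [2, 3, 15, 20, 45, 52, 117], [2, 5, 9, 20, 21, 28, 45, 50, 75],
     [2, 5, 7, 16, 20, 56, 70, 80], [2, 3, 20, 28, 40, 45, 56, 63],
     [2, 5, 7, 20, 21, 28, 70, 105], [2, 8, 10, 11, 14, 20, 28, 56, 110],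
     [3, 5, 7, 8, 15, 16, 21, 80, 105], [2, 5, 7, 11, 21, 105, 110],
     [2, 5, 9, 19, 21, 28, 45, 57, 76], [2, 5, 14, 15, 17, 21, 34, 70, 85],
     [3, 5, 8, 10, 14, 15, 25, 28, 56, 100], [2, 5, 7, 14, 28, 38, 76, 95],
     [2, 3, 20, 28, 35, 45, 63, 70], [2, 3, 15, 20, 35, 80, 112],
     [3, 5, 7, 8, 10, 20, 40, 70, 105], [2, 3, 11, 35, 45, 63, 110],
     [2, 5, 7, 14, 28, 45, 52, 117], [2, 5, 8, 10, 33, 50, 75, 88],
     [2, 5, 9, 10, 22, 50, 75, 99], [2, 7, 8, 9, 21, 45, 50, 56, 75],
     [2, 3, 19, 26, 39, 52, 57, 76], [2, 5, 7, 15, 21, 56, 65, 104],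
     [2, 5, 7, 17, 21, 34, 85, 105], [2, 3, 14, 25, 28, 100, 105],
     [2, 5, 9, 10, 23, 45, 69, 115], [2, 5, 8, 10, 40, 45, 52, 117],
     [2, 5, 7, 15, 21, 50, 75, 105], [3, 5, 7, 9, 10, 21, 22, 99, 105],
     [2, 5, 7, 14, 22, 63, 70, 99], [2, 5, 8, 11, 22, 70, 77, 88],
     [2, 3, 16, 35, 40, 45, 63, 80], [2, 3, 15, 16, 65, 80, 104], [2, 3, 10, 40, 56, 70, 105],
     [2, 3, 11, 33, 40, 88, 110], [2, 3, 15, 35, 45, 50, 63, 75],
     [2, 3, 20, 28, 35, 40, 56, 105], [2, 5, 10, 15, 21, 28, 38, 76, 95],
     [2, 5, 9, 14, 21, 45, 50, 70, 75], [2, 5, 7, 14, 22, 55, 77, 110],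
     [2, 3, 16, 28, 45, 56, 63, 80], [2, 5, 8, 20, 22, 35, 40, 63, 99],
     [2, 5, 7, 16, 25, 28, 100, 112], [2, 8, 9, 11, 15, 16, 45, 80, 110],
     [2, 7, 9, 10, 14, 35, 45, 70, 105], [2, 5, 9, 16, 20, 33, 45, 80, 88],
     [2, 5, 9, 15, 25, 28, 45, 70, 100], [2, 5, 8, 9, 45, 56, 70, 105],
     [2, 5, 7, 11, 40, 56, 70, 110], [2, 3, 17, 33, 34, 40, 85, 88],
     [2, 5, 7, 16, 21, 35, 105, 112], [2, 3, 21, 25, 28, 50, 75, 100],
     [2, 3, 10, 33, 70, 77, 110], [2, 3, 15, 33, 40, 50, 75, 88],
     [2, 5, 8, 15, 26, 39, 56, 65, 91], [2, 3, 20, 28, 33, 35, 77, 110],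
     [2, 5, 9, 19, 20, 22, 57, 76, 99], [2, 5, 7, 14, 20, 70, 80, 112],
     [2, 3, 20, 25, 33, 40, 88, 100], [3, 5, 7, 8, 14, 23, 28, 40, 69, 115],
     [2, 5, 9, 15, 22, 33, 40, 88, 99], [2, 7, 8, 15, 21, 22, 40, 55, 56, 88],
     [2, 3, 9, 55, 70, 77, 99], [2, 5, 7, 17, 34, 40, 56, 70, 85],
     [2, 5, 11, 14, 15, 35, 50, 75, 110], [2, 5, 7, 10, 55, 63, 77, 99],
     [2, 5, 7, 10, 56, 65, 70, 104], [2, 3, 16, 28, 33, 70, 80, 88],
     [3, 5, 7, 9, 10, 22, 40, 56, 70, 99], [2, 3, 14, 16, 70, 105, 112],
     [2, 5, 9, 15, 20, 35, 45, 80, 112], [2, 5, 7, 10, 50, 70, 75, 105],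
     [2, 3, 16, 28, 35, 56, 80, 105], [2, 5, 7, 20, 26, 39, 52, 70, 105],
     [2, 3, 15, 28, 38, 70, 76, 95], [2, 3, 20, 21, 33, 56, 88, 105],
     [2, 3, 16, 33, 35, 40, 88, 112], [2, 3, 20, 23, 28, 69, 70, 115],
     [2, 5, 10, 14, 16, 35, 65, 80, 104], [2, 3, 15, 28, 45, 52, 70, 117],
     [2, 5, 8, 16, 21, 40, 56, 80, 105], [2, 5, 8, 16, 25, 28, 70, 80, 100],
     [2, 3, 14, 33, 40, 56, 77, 110], [2, 3, 15, 28, 40, 56, 80, 112],
     [2, 5, 8, 15, 21, 50, 56, 75, 105], [2, 3, 16, 28, 33, 56, 88, 112],
     [2, 5, 8, 14, 22, 56, 63, 70, 99], [2, 3, 10, 28, 80, 105, 112],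
     [2, 5, 9, 15, 16, 45, 65, 80, 104], [2, 3, 20, 22, 28, 63, 99, 105],
     [2, 5, 8, 16, 22, 35, 55, 88, 112], [2, 5, 8, 15, 20, 50, 65, 75, 104],
     [2, 3, 15, 28, 35, 70, 80, 112], [2, 3, 15, 26, 39, 65, 91, 105],
     [2, 3, 16, 25, 33, 80, 88, 100], [2, 3, 17, 23, 34, 69, 85, 115],
     [2, 3, 16, 21, 50, 70, 75, 112], [2, 5, 8, 19, 35, 40, 45, 57, 63, 76],
     [2, 3, 9, 40, 88, 99, 110], [2, 3, 15, 23, 50, 69, 75, 115],
     [2, 3, 22, 35, 40, 45, 55, 63, 88], [2, 3, 15, 22, 55, 65, 88, 104],
     [2, 5, 8, 16, 21, 33, 70, 88, 112], [2, 5, 9, 16, 21, 22, 70, 99, 112],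
     [2, 3, 20, 23, 25, 69, 100, 115], [2, 5, 9, 17, 33, 34, 40, 45, 85, 88],
     [2, 3, 15, 25, 45, 52, 100, 117], [2, 5, 8, 15, 22, 40, 52, 99, 117],
     [2, 3, 14, 28, 38, 76, 95, 105], [2, 8, 9, 15, 20, 22, 28, 45, 55, 70, 88],
     [2, 3, 26, 28, 39, 45, 52, 63, 105], [2, 7, 8, 14, 16, 28, 38, 76, 80, 95],
     [2, 3, 21, 33, 40, 45, 63, 70, 88], [2, 3, 14, 28, 45, 52, 105, 117],
     [2, 3, 16, 21, 45, 63, 105, 112], [2, 7, 9, 11, 20, 21, 55, 56, 88, 99],
     [2, 7, 8, 10, 26, 33, 39, 65, 88, 91], [2, 3, 21, 35, 40, 45, 56, 63, 105],
     [2, 3, 15, 21, 56, 65, 104, 105], [2, 3, 15, 25, 35, 80, 100, 112],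
     [2, 5, 7, 14, 33, 50, 75, 77, 110], [2, 5, 7, 15, 28, 50, 75, 80, 112],
     [2, 3, 16, 23, 35, 69, 112, 115], [2, 5, 9, 16, 28, 33, 45, 70, 80, 88],
     [2, 3, 20, 35, 38, 45, 63, 76, 95], [2, 3, 14, 22, 63, 70, 99, 105],
     [2, 3, 14, 28, 35, 80, 105, 112], [2, 3, 19, 28, 50, 57, 70, 75, 76],
     [2, 5, 9, 14, 15, 63, 65, 91, 117], [2, 5, 8, 11, 33, 50, 75, 88, 110],
     [2, 5, 9, 11, 22, 50, 75, 99, 110], [2, 5, 7, 16, 28, 45, 52, 112, 117],
     [2, 5, 8, 11, 38, 40, 76, 95, 110], [2, 3, 20, 28, 45, 56, 63, 65, 104],
     [2, 5, 9, 19, 22, 28, 57, 70, 76, 99], [2, 3, 14, 22, 55, 77, 105, 110],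
     [2, 3, 25, 28, 33, 40, 70, 88, 100], [3, 5, 7, 9, 11, 14, 55, 77, 99, 110],
     [2, 3, 16, 25, 28, 100, 105, 112], [2, 8, 9, 16, 21, 22, 28, 35, 40, 99, 112],
     [2, 3, 21, 28, 45, 50, 52, 75, 117], [2, 3, 22, 28, 33, 56, 63, 88, 99],
     [2, 3, 20, 33, 38, 40, 76, 88, 95], [2, 5, 7, 16, 22, 63, 70, 99, 112],
     [2, 3, 11, 40, 56, 70, 105, 110], [2, 7, 8, 9, 22, 50, 56, 70, 75, 99],
     [2, 7, 8, 14, 16, 22, 56, 63, 99, 112], [2, 5, 8, 17, 34, 38, 40, 76, 85, 95],
     [2, 5, 8, 20, 26, 39, 40, 65, 91, 105], [2, 5, 8, 21, 22, 40, 55, 56, 88, 105],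
     [2, 5, 9, 16, 25, 33, 45, 80, 88, 100], [2, 7, 8, 9, 21, 55, 56, 70, 77, 99],
     [2, 3, 21, 22, 50, 63, 70, 75, 99], [2, 3, 21, 28, 33, 56, 70, 88, 105],
     [2, 3, 16, 40, 45, 56, 63, 70, 112], [2, 5, 8, 10, 45, 52, 65, 104, 117],
     [2, 5, 8, 20, 22, 38, 55, 76, 88, 95], [2, 3, 15, 40, 55, 56, 63, 77, 99],
     [2, 3, 21, 23, 45, 63, 69, 70, 115], [2, 3, 17, 34, 40, 56, 70, 85, 105],
     [2, 3, 16, 35, 45, 63, 65, 80, 104], [2, 3, 10, 55, 63, 77, 99, 105],
     [2, 3, 10, 56, 65, 70, 104, 105], [2, 3, 22, 23, 40, 55, 69, 88, 115],
     [2, 5, 8, 16, 28, 38, 70, 76, 80, 95], [2, 3, 15, 35, 55, 63, 70, 77, 99],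
     [2, 7, 8, 10, 21, 28, 65, 70, 104, 105], [2, 5, 7, 21, 33, 38, 56, 76, 88, 95],
     [2, 5, 10, 15, 16, 50, 65, 75, 80, 104], [2, 5, 8, 16, 28, 45, 52, 70, 80, 117],
     [2, 5, 8, 16, 33, 35, 50, 75, 88, 112], [2, 5, 14, 16, 19, 33, 35, 57, 76, 80, 88],
     [2, 5, 8, 16, 35, 38, 40, 76, 95, 112], [2, 5, 9, 15, 25, 35, 45, 80, 100, 112],
     [2, 7, 8, 14, 20, 28, 55, 56, 63, 77, 99], [2, 5, 8, 11, 25, 65, 100, 104, 110],
     [2, 3, 22, 23, 35, 63, 69, 99, 115], [2, 5, 8, 16, 35, 40, 45, 52, 112, 117],
     [2, 3, 21, 25, 33, 56, 88, 100, 105], [2, 3, 15, 40, 45, 56, 65, 91, 117],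
     [2, 3, 15, 33, 50, 65, 75, 88, 104], [2, 3, 16, 33, 45, 52, 80, 88, 117],
     [2, 5, 8, 16, 26, 39, 65, 80, 91, 105], [2, 3, 10, 45, 65, 91, 105, 117],
     [2, 3, 16, 35, 40, 56, 70, 105, 112], [2, 3, 20, 25, 33, 65, 88, 100, 104],
     [2, 3, 20, 23, 38, 69, 76, 95, 115], [2, 5, 9, 15, 22, 33, 65, 88, 99, 104],
     [2, 3, 21, 23, 35, 69, 70, 105, 115], [2, 5, 7, 16, 40, 55, 63, 77, 80, 99],
     [2, 5, 7, 16, 45, 50, 63, 70, 75, 112], [2, 3, 20, 21, 52, 55, 77, 99, 117],
     [2, 3, 26, 39, 40, 50, 56, 65, 75, 91], [2, 7, 8, 14, 16, 45, 50, 56, 63, 75, 112],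
     [2, 3, 16, 33, 40, 56, 77, 110, 112], [2, 5, 7, 16, 40, 50, 70, 75, 80, 105],
     [2, 5, 9, 10, 50, 55, 70, 75, 77, 99], [2, 3, 14, 35, 55, 63, 77, 99, 105],
     [2, 3, 14, 35, 56, 65, 70, 104, 105], [2, 3, 15, 35, 40, 63, 88, 99, 110],
     [2, 3, 15, 35, 40, 65, 80, 104, 112], [2, 3, 16, 25, 56, 70, 80, 100, 105],
     [2, 3, 16, 33, 35, 65, 88, 104, 112], [2, 3, 20, 23, 35, 69, 80, 112, 115],
     [2, 5, 8, 21, 33, 45, 50, 63, 70, 75, 88], [2, 3, 15, 35, 45, 52, 80, 112, 117],
     [2, 5, 8, 16, 21, 56, 65, 80, 104, 105], [2, 5, 8, 16, 22, 55, 56, 77, 110, 112],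
     [2, 3, 28, 35, 40, 45, 56, 63, 80, 112], [2, 3, 15, 28, 56, 65, 80, 104, 112],
     [2, 3, 17, 28, 34, 80, 85, 105, 112], [2, 8, 9, 10, 15, 38, 45, 65, 76, 95, 104],
     [2, 5, 7, 16, 40, 45, 65, 80, 91, 117], [2, 3, 14, 33, 50, 75, 77, 105, 110],
     [2, 3, 15, 28, 50, 75, 80, 105, 112], [2, 5, 7, 16, 35, 55, 63, 77, 99, 112],
     [2, 5, 7, 15, 45, 50, 65, 75, 91, 117], [2, 5, 8, 20, 35, 40, 55, 63, 70, 77, 99],
     [2, 3, 16, 28, 38, 76, 95, 105, 112], [2, 5, 8, 15, 28, 33, 80, 88, 105, 112],
     [2, 3, 14, 35, 45, 65, 91, 105, 117], [2, 3, 28, 33, 40, 45, 52, 70, 88, 117],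
     [2, 5, 8, 19, 35, 45, 57, 63, 65, 76, 104], [2, 3, 9, 65, 88, 99, 104, 110],
     [2, 3, 21, 35, 50, 56, 65, 70, 75, 104], [2, 5, 9, 21, 22, 40, 50, 56, 75, 99, 105],
     [2, 5, 8, 23, 28, 40, 50, 69, 70, 75, 115], [2, 7, 8, 9, 33, 45, 55, 63, 77, 88, 99],
     [2, 5, 9, 16, 33, 38, 45, 76, 80, 88, 95], [2, 5, 9, 21, 22, 35, 56, 65, 70, 99, 104],
     [2, 5, 8, 15, 22, 52, 65, 99, 104, 117], [2, 5, 8, 20, 33, 38, 50, 75, 76, 88, 95],
     [2, 3, 20, 40, 45, 56, 63, 70, 80, 112], [2, 3, 21, 33, 45, 63, 65, 70, 88, 104],
     [2, 3, 22, 35, 40, 56, 63, 70, 99, 105], [2, 3, 28, 33, 35, 38, 76, 77, 95, 110],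
     [2, 5, 7, 14, 40, 63, 70, 88, 99, 110], [2, 3, 19, 39, 52, 56, 57, 76, 91, 104],
     [2, 3, 25, 33, 38, 40, 76, 88, 95, 100], [2, 3, 16, 22, 55, 77, 105, 110, 112],
     [2, 3, 21, 33, 45, 56, 63, 80, 88, 112], [2, 3, 21, 35, 45, 50, 65, 75, 91, 117],
     [2, 3, 20, 38, 40, 56, 70, 76, 95, 105], [2, 7, 9, 11, 21, 22, 56, 65, 99, 104, 110],
     [2, 5, 8, 16, 40, 50, 56, 70, 75, 80, 105], [2, 3, 19, 35, 50, 57, 75, 76, 80, 112],
     [2, 3, 20, 40, 45, 52, 56, 70, 105, 117], [2, 3, 14, 25, 70, 80, 100, 105, 112],
     [2, 5, 9, 15, 35, 38, 45, 76, 80, 95, 112], [2, 7, 8, 9, 15, 70, 88, 99, 105, 110],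
     [2, 3, 22, 33, 35, 63, 65, 88, 99, 104], [2, 5, 8, 14, 21, 63, 88, 99, 105, 110],
     [2, 5, 9, 15, 28, 52, 56, 63, 65, 104, 117], [2, 3, 15, 22, 65, 91, 99, 105, 117],
     [2, 3, 20, 33, 45, 56, 65, 88, 91, 117], [2, 5, 9, 15, 28, 50, 52, 63, 75, 105, 117],
     [2, 3, 21, 33, 45, 52, 56, 88, 105, 117], [2, 3, 20, 35, 40, 56, 70, 80, 105, 112],
     [2, 3, 21, 28, 52, 55, 70, 77, 99, 117], [2, 3, 11, 55, 63, 77, 99, 105, 110],
     [2, 3, 11, 56, 65, 70, 104, 105, 110], [2, 5, 8, 11, 39, 52, 91, 104, 105, 110],
     [2, 3, 23, 28, 40, 56, 69, 80, 112, 115], [2, 3, 21, 28, 45, 63, 70, 80, 105, 112],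
     [2, 3, 22, 28, 38, 63, 76, 95, 99, 105], [2, 3, 20, 34, 40, 56, 68, 85, 105, 119],
     [2, 3, 20, 33, 40, 56, 77, 80, 110, 112], [2, 5, 8, 20, 25, 45, 56, 65, 91, 100, 117],
     [2, 3, 21, 33, 35, 56, 80, 88, 105, 112], [2, 3, 22, 28, 45, 52, 63, 99, 105, 117],
     [2, 3, 23, 28, 35, 69, 70, 80, 112, 115], [2, 3, 21, 25, 50, 70, 75, 80, 100, 112],
     [2, 3, 15, 55, 56, 63, 65, 77, 99, 104], [2, 3, 17, 34, 56, 65, 70, 85, 104, 105],
     [2, 3, 20, 33, 35, 65, 80, 88, 104, 112], [2, 5, 8, 20, 25, 45, 52, 65, 100, 104, 117],
     [2, 3, 15, 50, 55, 63, 75, 77, 99, 105], [2, 3, 15, 50, 56, 65, 70, 75, 104, 105],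
     [2, 5, 9, 16, 22, 45, 63, 70, 99, 105, 112], [2, 3, 11, 45, 65, 91, 105, 110, 117],
     [2, 3, 20, 33, 34, 68, 77, 85, 110, 119], [2, 5, 9, 15, 28, 35, 56, 88, 99, 105, 110],
     [2, 5, 9, 16, 20, 50, 75, 80, 88, 99, 110], [2, 5, 8, 14, 40, 56, 63, 70, 88, 99, 110],
     [2, 3, 20, 28, 38, 76, 80, 95, 105, 112], [2, 5, 9, 16, 19, 57, 76, 80, 88, 99, 110],
     [2, 3, 16, 40, 45, 65, 80, 91, 105, 117], [2, 3, 35, 38, 40, 45, 63, 65, 76, 95, 104],
     [2, 8, 9, 10, 22, 25, 50, 65, 75, 99, 100, 104],
     [2, 3, 28, 39, 50, 52, 56, 70, 75, 91, 104], [2, 3, 21, 28, 33, 77, 80, 105, 110, 112],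
     [2, 5, 9, 16, 21, 40, 70, 88, 99, 110, 112], [2, 5, 9, 21, 33, 38, 45, 56, 76, 88, 95, 105],
     [2, 3, 28, 33, 55, 56, 63, 70, 77, 88, 99], [2, 3, 21, 22, 52, 70, 80, 99, 112, 117],
     [2, 5, 9, 15, 20, 56, 70, 88, 99, 105, 110], [2, 3, 28, 38, 45, 50, 63, 75, 76, 95, 105],
     [2, 3, 16, 33, 50, 75, 77, 105, 110, 112], [2, 3, 15, 35, 63, 65, 88, 99, 104, 110],
     [2, 3, 15, 34, 68, 70, 80, 85, 112, 119], [2, 3, 33, 38, 40, 45, 52, 76, 88, 95, 117],
     [2, 5, 9, 16, 22, 33, 77, 99, 105, 110, 112],
     [3, 5, 7, 8, 10, 45, 52, 65, 70, 104, 105, 117],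
     [2, 5, 8, 21, 38, 45, 63, 65, 70, 76, 95, 104], [2, 3, 28, 35, 50, 52, 55, 75, 77, 99, 117],
     [2, 3, 14, 40, 63, 70, 88, 99, 105, 110], [2, 3, 28, 33, 45, 56, 65, 70, 88, 91, 117],
     [2, 5, 15, 20, 22, 35, 40, 50, 55, 75, 80, 88, 112],
     [2, 3, 14, 45, 52, 70, 80, 105, 112, 117], [2, 3, 25, 33, 55, 56, 63, 77, 88, 99, 100],
     [2, 5, 9, 21, 28, 34, 55, 68, 77, 85, 99, 119],
     [2, 5, 8, 20, 35, 55, 63, 65, 70, 77, 99, 104],
     [2, 5, 8, 20, 45, 50, 52, 56, 70, 75, 105, 117],
     [2, 5, 9, 20, 25, 45, 56, 65, 70, 100, 104, 105],
     [2, 3, 28, 35, 38, 56, 65, 76, 95, 104, 105], [2, 3, 26, 39, 45, 50, 56, 75, 91, 104, 117],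
     [2, 7, 8, 14, 35, 38, 40, 55, 63, 76, 77, 95, 99],
     [2, 3, 28, 33, 40, 56, 65, 80, 88, 104, 112],
     [2, 5, 8, 22, 35, 45, 52, 63, 65, 99, 104, 117],
     [2, 5, 8, 20, 35, 50, 56, 70, 75, 80, 105, 112],
     [2, 5, 8, 21, 34, 45, 63, 65, 68, 85, 104, 119],
     [2, 5, 8, 21, 33, 38, 70, 76, 80, 88, 95, 112], [2, 3, 22, 35, 50, 65, 70, 75, 91, 99, 117],
     [2, 3, 20, 38, 56, 65, 70, 76, 95, 104, 105],
     [2, 5, 8, 20, 35, 45, 56, 65, 80, 91, 112, 117],
     [2, 3, 22, 34, 55, 56, 68, 85, 88, 105, 119], [2, 3, 21, 38, 45, 63, 76, 80, 95, 105, 112],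
     [2, 5, 9, 16, 33, 40, 63, 65, 88, 91, 112, 117],
     [2, 5, 9, 28, 35, 38, 50, 55, 75, 76, 77, 95, 99],
     [2, 3, 23, 33, 45, 63, 69, 77, 105, 110, 115], [2, 5, 8, 11, 55, 65, 88, 91, 99, 105, 117],
     [2, 5, 9, 16, 28, 50, 56, 75, 88, 99, 110, 112],
     [2, 3, 20, 35, 56, 65, 70, 80, 104, 105, 112], [2, 3, 21, 35, 52, 56, 70, 88, 99, 110, 117],
     [2, 5, 8, 21, 28, 50, 52, 75, 88, 99, 110, 117],
     [2, 3, 23, 28, 56, 63, 69, 88, 99, 110, 115],
     [2, 5, 9, 23, 40, 45, 55, 56, 63, 69, 77, 99, 115],
     [2, 5, 8, 15, 55, 56, 65, 70, 77, 91, 99, 117],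
     [2, 3, 19, 40, 52, 57, 76, 88, 99, 110, 117],
     [2, 5, 14, 16, 22, 35, 50, 63, 70, 75, 99, 105, 112],
     [2, 3, 16, 55, 63, 65, 77, 80, 99, 104, 105], [2, 3, 19, 33, 57, 76, 77, 80, 105, 110, 112],
     [2, 3, 20, 35, 45, 65, 80, 91, 105, 112, 117],
     [2, 3, 33, 45, 50, 56, 63, 70, 75, 80, 88, 112],
     [2, 5, 9, 21, 38, 45, 50, 70, 75, 76, 80, 95, 112],
     [2, 5, 10, 16, 22, 35, 65, 91, 99, 105, 112, 117],
     [2, 3, 38, 40, 45, 56, 63, 70, 76, 80, 95, 112],
     [2, 3, 22, 25, 63, 70, 80, 99, 100, 105, 112],
     [2, 5, 8, 33, 38, 39, 52, 56, 76, 88, 91, 95, 104],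
     [2, 5, 8, 16, 40, 52, 55, 77, 99, 105, 112, 117],
     [2, 3, 16, 50, 52, 75, 80, 88, 99, 110, 117],
     [2, 5, 9, 26, 35, 39, 40, 52, 80, 88, 99, 110, 112],
     [2, 5, 9, 16, 21, 65, 70, 88, 99, 104, 110, 112],
     [2, 5, 8, 33, 35, 45, 50, 52, 75, 80, 88, 112, 117],
     [2, 5, 9, 21, 35, 38, 56, 70, 76, 88, 95, 99, 110],
     [2, 5, 8, 20, 23, 52, 69, 88, 99, 110, 115, 117],
     [2, 3, 33, 35, 50, 56, 70, 75, 80, 88, 105, 112],
     [2, 3, 33, 40, 45, 50, 65, 75, 88, 91, 105, 117],
     [2, 3, 28, 45, 52, 55, 63, 70, 77, 99, 105, 117],
     [2, 3, 15, 52, 56, 70, 88, 99, 105, 110, 117],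
     [2, 3, 33, 40, 45, 52, 65, 70, 77, 104, 110, 117],
     [2, 5, 8, 28, 40, 45, 50, 52, 75, 80, 105, 112, 117],
     [2, 3, 34, 38, 40, 56, 68, 76, 85, 95, 105, 119],
     [2, 3, 33, 38, 40, 56, 76, 77, 80, 95, 110, 112],
     [2, 5, 9, 20, 35, 39, 52, 70, 88, 91, 99, 104, 110],
     [2, 3, 25, 50, 52, 55, 70, 75, 77, 99, 100, 117],
     [2, 3, 33, 39, 40, 52, 70, 77, 91, 104, 105, 110],
     [2, 3, 33, 35, 45, 56, 65, 80, 88, 91, 112, 117],
     [2, 3, 15, 40, 65, 88, 91, 99, 105, 110, 117],
     [2, 3, 28, 40, 45, 56, 65, 80, 91, 105, 112, 117],
     [2, 5, 9, 15, 45, 56, 63, 70, 80, 88, 99, 110, 112],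
     [2, 5, 8, 22, 33, 56, 65, 70, 77, 91, 99, 110, 117],
     [2, 5, 9, 16, 38, 52, 63, 70, 76, 95, 105, 112, 117],
     [2, 3, 25, 34, 56, 65, 68, 85, 100, 104, 105, 119],
     [2, 3, 25, 33, 56, 65, 77, 80, 100, 104, 110, 112],
     [2, 5, 15, 16, 20, 55, 56, 65, 70, 77, 80, 91, 99, 117],
     [2, 3, 22, 38, 55, 76, 77, 80, 95, 105, 110, 112],
     [2, 5, 9, 33, 38, 39, 45, 52, 76, 88, 91, 95, 104, 105],
     [2, 8, 10, 15, 16, 25, 35, 52, 88, 99, 100, 110, 112, 117],
     [2, 5, 9, 15, 40, 45, 65, 88, 91, 99, 105, 110, 117],
     [2, 3, 20, 40, 63, 70, 80, 88, 99, 105, 110, 112],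
     [2, 3, 22, 33, 65, 70, 77, 91, 99, 105, 110, 117],
     [2, 5, 9, 26, 38, 39, 56, 65, 76, 88, 91, 95, 99, 110],
     [2, 5, 9, 28, 35, 40, 52, 63, 65, 80, 104, 105, 112, 117],
     [2, 5, 8, 33, 40, 52, 55, 56, 77, 80, 88, 99, 112, 117],
     [2, 5, 8, 28, 45, 50, 56, 65, 75, 80, 91, 105, 112, 117],
     [2, 5, 8, 33, 35, 45, 63, 65, 77, 80, 104, 105, 110, 112],
     [2, 3, 25, 50, 56, 65, 75, 88, 91, 99, 100, 110, 117],
     [2, 5, 9, 28, 45, 50, 52, 65, 70, 75, 88, 99, 104, 110, 117],
     [2, 3, 20, 63, 65, 70, 80, 88, 99, 104, 105, 110, 112],
     [2, 7, 9, 16, 34, 38, 45, 65, 68, 76, 80, 85, 95, 104, 105, 119]]"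

definition extra_seeds6 :: "nat list list" where
  "extra_seeds6 = [
     [3, 4, 8, 9, 10, 22, 40, 99], [3, 4, 7, 10, 15, 28, 35, 40, 56],
     [3, 4, 5, 8, 35, 40, 45, 63]]"

lemma six_free_partition:
  assumes "183 \<le> n"
  shows "\<exists>A. one_partition n A \<and> is_free 6 A"
proof (cases "claimed 60 204 gaps6 n")
  case True
  have "\<exists>A. avoiding_partition 6 {1, 4, 13, 44} n A"
  proof (rule avoiding_partition_exists[OF _ _ _ _ _ _ _ _ _ _ True])
    show "2 \<le> (5 :: nat)"
      by simp
    show "coprime 6 (5 :: nat)"
      by code_simp
    show "\<forall>b\<in>{1, 4, 13, 44}. \<not> 5 dvd (b :: nat)"
      by code_simp
    show "\<forall>ys\<in>set lifters6. lifter 6 5 {1, 4, 13, 44} ys"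
      by code_simp
    show "map sum_list lifters6 = shifts6"
      by code_simp
    show "\<forall>xs\<in>set seeds6. seed 6 {1, 4, 13, 44} xs"
      by code_simp
    show "map sum_list seeds6 =
      filter (\<lambda>n. if claimed 60 204 gaps6 n
                 then \<not> liftable 5 (claimed 60 204 gaps6) shifts6 n else False)
        [60..<1279]"
      by code_simp
    show "\<forall>j\<in>set [0..<5]. \<exists>s\<in>set shifts6. s mod 5 = j \<and> 5 * 204 + s \<le> 1279"
      by code_simp
  qed simp_all
  then show ?thesis
    by (auto simp: avoiding_partition_def)
next
  case False
  with assms have "n \<in> set (map sum_list extra_seeds6)"
    by (auto simp: claimed_def gaps6_def extra_seeds6_def)
  then obtain xs where "xs \<in> set extra_seeds6" and n: "n = sum_list xs"
    by auto
  moreover have "\<forall>xs\<in>set extra_seeds6. seed 6 {} xs"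
    by code_simp
  ultimately have "avoiding_partition 6 {} n (set xs)"
    unfolding n by (intro seed_partition) blast
  then show ?thesis
    by (auto simp: avoiding_partition_def)
qed

section \<open>Partitions without multiples of 9\<close>

text \<open>Here \<open>k = 2\<close> and \<open>B = {1, 7}\<close>. Even numbers are lifted with \<open>{2}\<close>, as in Graham's proof, and odd
  numbers with a set of sum 67. The numbers 100 and 107 are gaps above the bound 91, which puts \<open>t\<close> at
  108 and \<open>hi\<close> at \<open>2 * 108 + 67 = 283\<close>; their partitions \<open>extra_seeds9\<close> contain 7.\<close>

definition lifters9 :: "nat list list" where
  "lifters9 = [
     [2], [3, 14, 15, 35]]"

definition shifts9 :: "nat list" where
  "shifts9 = [
     2, 67]"

definition gaps9 :: "nat list" where
  "gaps9 = [
     10, 12, 13, 14, 15, 16, 17, 18, 19, 20, 21, 22, 23, 25, 26, 27, 28, 29, 32, 33, 34, 35, 36,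
     39, 40, 41, 42, 44, 46, 47, 48, 49, 51, 52, 54, 55, 56, 58, 59, 60, 63, 68, 70, 72, 73, 74,
     77, 83, 90, 100, 107]"

definition seeds9 :: "nat list list" where
  "seeds9 = [
     [2, 3, 6], [2, 3, 10, 15], [2, 4, 5, 20], [2, 3, 8, 24], [3, 4, 5, 6, 20],
     [2, 4, 10, 12, 15], [2, 5, 6, 12, 20], [2, 5, 6, 10, 30], [3, 4, 6, 8, 12, 24],
     [2, 4, 6, 21, 28], [2, 6, 8, 10, 15, 24], [2, 3, 12, 21, 28], [2, 3, 12, 20, 30],
     [2, 3, 14, 15, 35], [2, 3, 11, 22, 33], [3, 4, 5, 8, 15, 40], [2, 3, 10, 24, 40],
     [2, 4, 10, 15, 21, 28], [2, 3, 12, 16, 48], [2, 5, 6, 20, 21, 28], [2, 4, 11, 12, 22, 33],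
     [2, 5, 8, 10, 20, 40], [3, 5, 6, 8, 10, 24, 30], [2, 4, 6, 15, 60],
     [3, 4, 6, 11, 12, 22, 33], [3, 4, 5, 12, 20, 21, 28], [3, 4, 6, 8, 21, 24, 28],
     [2, 3, 10, 20, 60], [3, 4, 5, 14, 15, 20, 35], [2, 5, 6, 16, 20, 48],
     [3, 4, 5, 11, 20, 22, 33], [2, 4, 8, 15, 30, 40], [2, 4, 5, 30, 60], [2, 4, 8, 14, 35, 40],
     [2, 3, 20, 21, 28, 30], [2, 5, 11, 12, 20, 22, 33], [3, 4, 6, 8, 15, 30, 40],
     [2, 4, 5, 28, 70], [2, 4, 6, 14, 84], [2, 3, 8, 42, 56], [2, 4, 8, 14, 28, 56],
     [2, 3, 8, 40, 60], [2, 3, 15, 24, 30, 40], [2, 6, 8, 12, 14, 35, 40], [2, 5, 6, 14, 21, 70],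
     [2, 3, 16, 20, 30, 48], [3, 4, 6, 8, 15, 24, 60], [2, 5, 8, 10, 16, 80],
     [2, 4, 11, 20, 22, 30, 33], [2, 5, 6, 12, 28, 70], [3, 5, 6, 8, 14, 24, 30, 35],
     [3, 5, 6, 8, 10, 16, 80], [2, 5, 6, 14, 20, 84], [3, 4, 6, 8, 12, 40, 60],
     [3, 4, 5, 10, 15, 28, 70], [3, 4, 6, 8, 16, 20, 80], [2, 3, 15, 20, 28, 70],
     [2, 3, 12, 24, 42, 56], [3, 4, 5, 8, 24, 28, 70], [2, 3, 16, 20, 24, 80],
     [2, 4, 14, 15, 20, 21, 70], [2, 4, 8, 12, 33, 88], [2, 5, 6, 10, 50, 75],
     [2, 3, 12, 22, 44, 66], [2, 6, 8, 12, 14, 24, 84], [2, 5, 6, 10, 48, 80],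
     [2, 4, 8, 24, 26, 39, 52], [2, 3, 15, 16, 40, 80], [2, 4, 6, 21, 42, 84],
     [3, 4, 6, 8, 12, 32, 96], [2, 5, 8, 10, 28, 40, 70], [2, 5, 6, 20, 22, 44, 66],
     [3, 4, 5, 8, 20, 32, 96], [2, 3, 12, 24, 32, 96], [2, 6, 8, 11, 12, 44, 88],
     [2, 4, 8, 11, 40, 110], [2, 5, 8, 10, 24, 48, 80], [2, 4, 8, 20, 24, 55, 66],
     [3, 4, 6, 8, 11, 40, 110], [2, 3, 10, 32, 40, 96], [2, 5, 6, 19, 20, 57, 76],
     [2, 4, 8, 15, 42, 56, 60], [2, 4, 8, 10, 65, 104], [2, 4, 5, 44, 70, 77],
     [2, 3, 14, 28, 40, 56, 60], [2, 4, 5, 42, 70, 84], [2, 3, 16, 21, 44, 48, 77],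
     [2, 5, 6, 12, 48, 60, 80], [2, 3, 16, 24, 30, 60, 80], [2, 5, 6, 12, 44, 70, 77],
     [2, 3, 15, 20, 55, 60, 66], [2, 4, 8, 14, 33, 84, 88], [2, 4, 6, 35, 40, 48, 112],
     [2, 4, 6, 24, 56, 70, 105], [2, 5, 8, 10, 32, 48, 80, 96]]"

definition extra_seeds9 :: "nat list list" where
  "extra_seeds9 = [
     [2, 6, 7, 8, 21, 56], [2, 6, 7, 14, 20, 28, 30]]"

lemma nine_free_partition:
  assumes "91 \<le> n"
  shows "\<exists>A. one_partition n A \<and> is_free 9 A"
proof (cases "claimed 10 108 gaps9 n")
  case True
  have "\<exists>A. avoiding_partition 9 {1, 7} n A"
  proof (rule avoiding_partition_exists[OF _ _ _ _ _ _ _ _ _ _ True])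
    show "2 \<le> (2 :: nat)"
      by simp
    show "coprime 9 (2 :: nat)"
      by code_simp
    show "\<forall>b\<in>{1, 7}. \<not> 2 dvd (b :: nat)"
      by code_simp
    show "\<forall>ys\<in>set lifters9. lifter 9 2 {1, 7} ys"
      by code_simp
    show "map sum_list lifters9 = shifts9"
      by code_simp
    show "\<forall>xs\<in>set seeds9. seed 9 {1, 7} xs"
      by code_simp
    show "map sum_list seeds9 =
      filter (\<lambda>n. if claimed 10 108 gaps9 n
                 then \<not> liftable 2 (claimed 10 108 gaps9) shifts9 n else False)
        [10..<283]"
      by code_simp
    show "\<forall>j\<in>set [0..<2]. \<exists>s\<in>set shifts9. s mod 2 = j \<and> 2 * 108 + s \<le> 283"
      by code_simp
  qed simp_all
  then show ?thesis
    by (auto simp: avoiding_partition_def)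
next
  case False
  with assms have "n \<in> set (map sum_list extra_seeds9)"
    by (auto simp: claimed_def gaps9_def extra_seeds9_def)
  then obtain xs where "xs \<in> set extra_seeds9" and n: "n = sum_list xs"
    by auto
  moreover have "\<forall>xs\<in>set extra_seeds9. seed 9 {} xs"
    by code_simp
  ultimately have "avoiding_partition 9 {} n (set xs)"
    unfolding n by (intro seed_partition) blast
  then show ?thesis
    by (auto simp: avoiding_partition_def)
qed

section \<open>Multiples of 4, 6 and 9\<close>

lemma is_free_mono:
  assumes "is_free N A" and "N dvd M"
  shows "is_free M A"
  using assms by (auto simp: is_free_def intro: dvd_trans)

theorem proposition2:
  fixes M :: nat
  assumes "M \<ge> 2"
  shows "(4 dvd M \<longrightarrow> (\<forall>n::nat. n \<ge> 155 \<longrightarrow> (\<exists>A. one_partition n A \<and> is_free M A))) \<and>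
         (6 dvd M \<longrightarrow> (\<forall>n::nat. n \<ge> 183 \<longrightarrow> (\<exists>A. one_partition n A \<and> is_free M A))) \<and>
         (9 dvd M \<longrightarrow> (\<forall>n::nat. n \<ge> 91 \<longrightarrow> (\<exists>A. one_partition n A \<and> is_free M A)))"
  using four_free_partition six_free_partition nine_free_partition is_free_mono by blast

end
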